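(* Let $\Gamma$ be a compact abelian group (written multiplicatively), let $\varphi$ be the action of $\mathbb{N}^*$ by endomorphisms of $\Gamma$ given by $\varphi_n(s)=s^n$ for $n\in \mathbb{N}^*$, and let $\beta:\mathbb{N}^*\to \operatorname{End}(C(\Gamma))$ be given by $\beta_n(f)(t)=f(\varphi_n(t))$ for $n\in \mathbb{N}^*$ and $f\in C(\Gamma)$. If $\varphi_n$ is injective for all $n\in \mathbb{N}^*$ and if $[\Gamma:\varphi_n(\Gamma)]<\infty$ for all $n\in\mathbb{N}^*$, then $\beta$ is an action by surjective endomorphisms, the formula $$L_n(f)(t):=\begin{cases}\dfrac 1{|\{s\in \Gamma\mid \varphi_n(s)=t\}|}\displaystyle\sum_{\{s\in \Gamma\mid \varphi_n(s)=t\}}f(s)&\text{if }t\in \varphi_n(\Gamma),\\ 0&\text{otherwise}\end{cases}$$ becomes $$L_n(f)(t)=\begin{cases}f(\varphi_n^{-1}(t))&\text{if }t\in \varphi_n(\Gamma),\\ 0&\text{otherwise},\end{cases}$$ and $L$ is an action of $\mathbb{N}^*$ by endomorphisms of $C(\Gamma)$.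
   Context: $\mathbb{N}^*$ is the multiplicative semigroup of non-zero positive integers. $\operatorname{End}(C(\Gamma))$ is the set of (not necessarily unital) $*$-endomorphisms of the $C^*$-algebra $C(\Gamma)$. An action of $\mathbb{N}^*$ by endomorphisms is a semigroup homomorphism, i.e. $L_m\circ L_n=L_{mn}$ and $L_1=\operatorname{id}$. *)

theory Defs
  imports "HOL-Analysis.Analysis" "HOL-Algebra.Coset"
begin

text \<open>As usual for compact groups, the topology is required to be Hausdorff.\<close>

locale compact_abelian_group = comm_group G for G (structure) +
  fixes T :: "'a topology"
  assumes topspace_eq: "topspace T = carrier G"
    and compact: "compact_space T"
    and Hausdorff: "Hausdorff_space T"
    and continuous_mult: "continuous_map (prod_topology T T) T (\<lambda>(x, y). x \<otimes> y)"
    and continuous_inv: "continuous_map T T (\<lambda>x. inv x)"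

text \<open>
  The algebra of continuous complex functions on a topological space. Its elements are extensional
  (equal to \<^term>\<open>undefined\<close> outside the space), so that HOL equality of elements is equality of
  functions on the space; accordingly the pointwise operations below are restricted to the space.
\<close>

definition cont_fun :: "'a topology \<Rightarrow> ('a \<Rightarrow> complex) set" where
  "cont_fun X = {f \<in> extensional (topspace X). continuous_map X euclidean f}"

text \<open>The *-endomorphisms of \<^term>\<open>cont_fun X\<close>; they need not preserve the unit.\<close>

definition star_endo :: "'a topology \<Rightarrow> (('a \<Rightarrow> complex) \<Rightarrow> ('a \<Rightarrow> complex)) set" where
  "star_endo X = {h. h \<in> cont_fun X \<rightarrow> cont_fun X \<and>
     (\<forall>f\<in>cont_fun X. \<forall>g\<in>cont_fun X.
        h (\<lambda>t\<in>topspace X. f t + g t) = (\<lambda>t\<in>topspace X. h f t + h g t)) \<and>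
     (\<forall>c. \<forall>f\<in>cont_fun X. h (\<lambda>t\<in>topspace X. c * f t) = (\<lambda>t\<in>topspace X. c * h f t)) \<and>
     (\<forall>f\<in>cont_fun X. \<forall>g\<in>cont_fun X.
        h (\<lambda>t\<in>topspace X. f t * g t) = (\<lambda>t\<in>topspace X. h f t * h g t)) \<and>
     (\<forall>f\<in>cont_fun X. h (\<lambda>t\<in>topspace X. cnj (f t)) = (\<lambda>t\<in>topspace X. cnj (h f t)))}"

text \<open>
  An action on \<^term>\<open>A\<close>, by maps in \<^term>\<open>E\<close>, of the multiplicative semigroup of positive
  integers. Nothing is required of \<^term>\<open>\<alpha> 0\<close>.
\<close>

definition nat_action :: "'b set \<Rightarrow> ('b \<Rightarrow> 'b) set \<Rightarrow> (nat \<Rightarrow> 'b \<Rightarrow> 'b) \<Rightarrow> bool" where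
  "nat_action A E \<alpha> \<longleftrightarrow>
     (\<forall>n\<ge>1. \<alpha> n \<in> E) \<and>
     (\<forall>m\<ge>1. \<forall>n\<ge>1. \<forall>x\<in>A. \<alpha> m (\<alpha> n x) = \<alpha> (m * n) x) \<and>
     (\<forall>x\<in>A. \<alpha> 1 x = x)"

definition power_map :: "('a, 'm) monoid_scheme \<Rightarrow> nat \<Rightarrow> 'a \<Rightarrow> 'a" where
  "power_map G n s = s [^]\<^bsub>G\<^esub> n"

definition beta :: "('a, 'm) monoid_scheme \<Rightarrow> nat \<Rightarrow> ('a \<Rightarrow> complex) \<Rightarrow> 'a \<Rightarrow> complex" where
  "beta G n f = (\<lambda>t\<in>carrier G. f (power_map G n t))"

text \<open>
  The averaging formula is meaningful when the fibres of the power map are finite; an infinite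
  fibre would contribute the value 0 by the conventions for \<^term>\<open>card\<close> and \<^term>\<open>sum\<close>.
\<close>

definition transfer :: "('a, 'm) monoid_scheme \<Rightarrow> nat \<Rightarrow> ('a \<Rightarrow> complex) \<Rightarrow> 'a \<Rightarrow> complex" where
  "transfer G n f = (\<lambda>t\<in>carrier G.
     if t \<in> power_map G n ` carrier G
     then 1 / of_nat (card {s \<in> carrier G. power_map G n s = t}) *
          (\<Sum>s\<in>{s \<in> carrier G. power_map G n s = t}. f s)
     else 0)"

lemma (in compact_abelian_group) power_map_action:
  "nat_action (carrier G) {h \<in> hom G G. continuous_map T T h} (power_map G)"
proof -
  have cont: "continuous_map T T (\<lambda>s. s [^] n)" for n :: nat
  proof (induction n)
    case 0
    show ?case using topspace_eq by simp
  next
    case (Suc n)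
    have "continuous_map T (prod_topology T T) (\<lambda>s. (s [^] n, s))"
      using Suc by (simp add: continuous_map_pairedI)
    from continuous_map_compose[OF this continuous_mult] show ?case
      by (simp add: o_def)
  qed
  show ?thesis
    unfolding nat_action_def power_map_def
    using cont by (auto simp: hom_def nat_pow_distrib nat_pow_pow mult.commute)
qed

end

theory Submission
  imports Defs
begin

text \<open>
  Write \<open>\<phi>\<^sub>n\<close> for the power map and \<open>H\<^sub>n\<close> for its image. When \<open>\<phi>\<^sub>n\<close> is injective, every fibre of
  \<open>\<phi>\<^sub>n\<close> over \<open>H\<^sub>n\<close> is a singleton, so the average \<open>L\<^sub>n f\<close> is determined by two rules:
  \<open>L\<^sub>n f (\<phi>\<^sub>n s) = f s\<close>, and \<open>L\<^sub>n f\<close> vanishes off \<open>H\<^sub>n\<close> (\<open>transfer_power_map\<close> and \<open>transfer_outside\<close>).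
  The algebraic claims about \<open>L\<close> follow from these rules. In particular \<open>\<beta>\<^sub>n (L\<^sub>n f) = f\<close>, so \<open>\<beta>\<^sub>n\<close> is
  surjective as soon as \<open>L\<^sub>n f\<close> is continuous.

  Continuity of \<open>L\<^sub>n f\<close> is the topological heart of the matter, and the place where finiteness of
  the index enters.
  Extending \<open>f \<circ> \<phi>\<^sub>n\<^sup>-\<^sup>1\<close> from \<open>H\<^sub>n\<close> by zero is continuous because \<open>\<phi>\<^sub>n\<close> is a closed map (a
  continuous map from a compact space to a Hausdorff space) and because \<open>H\<^sub>n\<close> is open: its
  complement is the union of the finitely many other cosets, each of them closed
  (\<open>openin_closed_subgroup_of_finite_index\<close>).
\<close>

lemma in_cont_fun_iff:
  "f \<in> cont_fun X \<longleftrightarrow> f \<in> extensional (topspace X) \<and> continuous_map X euclidean f"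
  by (simp add: cont_fun_def)

lemma cont_fun_restrict:
  assumes "continuous_map X euclidean f"
  shows "(\<lambda>t\<in>topspace X. f t) \<in> cont_fun X"
proof -
  have "continuous_map X euclidean (\<lambda>t\<in>topspace X. f t)"
    by (rule continuous_map_eq[OF assms]) simp
  then show ?thesis
    by (simp add: in_cont_fun_iff)
qed

context compact_abelian_group
begin

lemma power_map_closed: "s \<in> carrier G \<Longrightarrow> power_map G n s \<in> carrier G"
  by (simp add: power_map_def)

lemma power_map_power_map:
  "s \<in> carrier G \<Longrightarrow> power_map G m (power_map G n s) = power_map G (m * n) s"
  by (simp add: power_map_def nat_pow_pow mult.commute)

lemma power_map_one: "s \<in> carrier G \<Longrightarrow> power_map G 1 s = s"
  by (simp add: power_map_def)

lemma continuous_map_power_map: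
  assumes "n \<ge> 1"
  shows "continuous_map T T (power_map G n)"
  using power_map_action assms by (auto simp: nat_action_def)

lemma closed_map_power_map:
  assumes "n \<ge> 1"
  shows "closed_map T T (power_map G n)"
  using continuous_imp_closed_map compact Hausdorff continuous_map_power_map[OF assms] by blast

lemma subgroup_power_map_image:
  assumes "n \<ge> 1"
  shows "subgroup (power_map G n ` carrier G) G"
proof -
  have "power_map G n \<in> hom G G"
    using power_map_action assms by (auto simp: nat_action_def)
  then interpret group_hom G G "power_map G n"
    by unfold_locales
  show ?thesis
    by (rule img_is_subgroup)
qed

text \<open>Right translations are closed maps of the compact Hausdorff space, so they
  carry a closed subgroup to closed cosets.\<close>

lemma closedin_r_coset:
  assumes "closedin T H" and a: "a \<in> carrier G"
  shows "closedin T (H #> a)"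
proof -
  have "continuous_map T (prod_topology T T) (\<lambda>x. (x, a))"
    using a topspace_eq by (simp add: continuous_map_pairedI)
  from continuous_map_compose[OF this continuous_mult]
  have "continuous_map T T (\<lambda>x. x \<otimes> a)"
    by (simp add: o_def)
  then have "closed_map T T (\<lambda>x. x \<otimes> a)"
    using continuous_imp_closed_map compact Hausdorff by blast
  moreover have "H #> a = (\<lambda>x. x \<otimes> a) ` H"
    by (auto simp: r_coset_def)
  ultimately show ?thesis
    using assms(1) by (simp add: closed_map_def)
qed

lemma openin_closed_subgroup_of_finite_index:
  assumes H: "subgroup H G" and closed: "closedin T H" and fin: "finite (rcosets H)"
  shows "openin T H"
proof -
  have "\<Union>(rcosets H) = carrier G"
    by (rule rcosets_part_G[OF H])
  moreover have "H \<in> rcosets H"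
    by (rule subgroup.subgroup_in_rcosets[OF H is_group])
  moreover have "C \<inter> H = {}" if "C \<in> rcosets H - {H}" for C
    using rcos_disjoint[OF H] that \<open>H \<in> rcosets H\<close> by (auto simp: pairwise_def disjnt_def)
  ultimately have "topspace T - H = \<Union>(rcosets H - {H})"
    unfolding topspace_eq by blast
  moreover have "closedin T (\<Union>(rcosets H - {H}))"
    using fin closedin_r_coset[OF closed]
    by (intro closedin_Union) (auto simp: RCOSETS_def)
  ultimately show ?thesis
    using openin_closedin_eq subgroup.subset[OF H] topspace_eq by metis
qed

lemma transfer_power_map:
  assumes inj: "inj_on (power_map G n) (carrier G)" and s: "s \<in> carrier G"
  shows "transfer G n f (power_map G n s) = f s"
proof -
  have "{u \<in> carrier G. power_map G n u = power_map G n s} = {s}"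
    using inj s by (auto dest: inj_onD)
  then show ?thesis
    using s power_map_closed[OF s] by (simp add: transfer_def)
qed

lemma transfer_outside:
  "t \<in> carrier G \<Longrightarrow> t \<notin> power_map G n ` carrier G \<Longrightarrow> transfer G n f t = 0"
  by (simp add: transfer_def)

lemma transfer_extensional: "transfer G n f \<in> extensional (carrier G)"
  by (simp add: transfer_def)

text \<open>This is how the two rules for the transfer are put to use: each algebraic identity for it
  becomes one between values \<open>f s\<close> on the image of the power map, and between zeros elsewhere.\<close>

lemma eq_by_power_map_image:
  assumes "f \<in> extensional (carrier G)" "g \<in> extensional (carrier G)"
    and "\<And>s. s \<in> carrier G \<Longrightarrow> f (power_map G n s) = g (power_map G n s)"
    and "\<And>t. t \<in> carrier G \<Longrightarrow> t \<notin> power_map G n ` carrier G \<Longrightarrow> f t = g t"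
  shows "f = g"
  using assms by (intro extensionalityI[of f "carrier G" g]) blast+

lemma transfer_eq_inverse:
  assumes inj: "inj_on (power_map G n) (carrier G)" and t: "t \<in> carrier G"
  shows "transfer G n f t =
    (if t \<in> power_map G n ` carrier G
     then f (inv_into (carrier G) (power_map G n) t) else 0)"
  using t transfer_outside[of t n f] transfer_power_map[OF inj, of _ f] inv_into_f_f[OF inj]
  by auto

text \<open>The preimage of a closed set \<open>C\<close> under \<open>L\<^sub>n f\<close> is \<open>\<phi>\<^sub>n (f\<^sup>-\<^sup>1 C)\<close>, closed because \<open>\<phi>\<^sub>n\<close> is a closed
  map, together with the complement of \<open>H\<^sub>n\<close> if \<open>0 \<in> C\<close>, closed because \<open>H\<^sub>n\<close> is open.\<close>

lemma transfer_cont_fun: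
  assumes n: "n \<ge> 1"
    and inj: "inj_on (power_map G n) (carrier G)"
    and fin: "finite (rcosets (power_map G n ` carrier G))"
    and f: "f \<in> cont_fun T"
  shows "transfer G n f \<in> cont_fun T"
proof -
  let ?H = "power_map G n ` carrier G"
  have closed_image: "closedin T (power_map G n ` C)" if "closedin T C" for C
    using closed_map_power_map[OF n] that by (simp add: closed_map_def)
  have "openin T ?H"
    using subgroup_power_map_image[OF n] closed_image fin topspace_eq
    by (metis openin_closed_subgroup_of_finite_index closedin_topspace)
  then have closed_compl: "closedin T (carrier G - ?H)"
    using closedin_diff closedin_topspace topspace_eq by metis
  have "closedin T {t \<in> topspace T. transfer G n f t \<in> C}" if C: "closed C" for C
  proof -
    have "{t \<in> topspace T. transfer G n f t \<in> C} =
        power_map G n ` {s \<in> topspace T. f s \<in> C} \<union> (if 0 \<in> C then carrier G - ?H else {})"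
      (is "?L = ?R")
    proof (rule Set.set_eqI)
      fix t
      show "t \<in> ?L \<longleftrightarrow> t \<in> ?R"
      proof (cases "t \<in> ?H")
        case True
        then obtain s where "s \<in> carrier G" "t = power_map G n s"
          by blast
        then show ?thesis
          using inj
          by (auto simp: topspace_eq transfer_power_map[OF inj] power_map_closed dest: inj_onD)
      next
        case False
        then show ?thesis
          using transfer_outside[of t n f] by (auto simp: topspace_eq)
      qed
    qed
    moreover have "closedin T {s \<in> topspace T. f s \<in> C}"
      using f C by (simp add: in_cont_fun_iff continuous_map_closedin)
    ultimately show ?thesis
      using closed_image closed_compl by (simp add: closedin_Un)
  qed
  then have "continuous_map T euclidean (transfer G n f)"
    by (simp add: continuous_map_closedin)
  then show ?thesis
    using transfer_extensional by (simp add: in_cont_fun_iff topspace_eq)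
qed

lemma transfer_star_endo:
  assumes "n \<ge> 1"
    and inj: "inj_on (power_map G n) (carrier G)"
    and "finite (rcosets (power_map G n ` carrier G))"
  shows "transfer G n \<in> star_endo T"
proof -
  note rules = transfer_extensional transfer_outside transfer_power_map[OF inj] power_map_closed
  show ?thesis
    unfolding star_endo_def topspace_eq
    by (auto intro!: transfer_cont_fun assms eq_by_power_map_image[where n = n] simp: rules)
qed

lemma transfer_transfer:
  assumes injm: "inj_on (power_map G m) (carrier G)"
    and injn: "inj_on (power_map G n) (carrier G)"
    and injmn: "inj_on (power_map G (m * n)) (carrier G)"
  shows "transfer G m (transfer G n f) = transfer G (m * n) f"
proof (rule eq_by_power_map_image[where n = "m * n"])
  fix s assume s: "s \<in> carrier G"
  then have "transfer G m (transfer G n f) (power_map G (m * n) s) = f s"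
    by (simp add: power_map_power_map[symmetric] power_map_closed
        transfer_power_map[OF injm] transfer_power_map[OF injn])
  then show "transfer G m (transfer G n f) (power_map G (m * n) s) =
      transfer G (m * n) f (power_map G (m * n) s)"
    by (simp add: transfer_power_map[OF injmn s])
next
  fix t assume t: "t \<in> carrier G" "t \<notin> power_map G (m * n) ` carrier G"
  have "transfer G m (transfer G n f) t = 0"
  proof (cases "t \<in> power_map G m ` carrier G")
    case True
    then obtain u where u: "u \<in> carrier G" "t = power_map G m u"
      by blast
    \<comment> \<open>An \<open>n\<close>-th root of \<open>u\<close> would be an \<open>mn\<close>-th root of \<open>t\<close>.\<close>
    have "u \<notin> power_map G n ` carrier G"
      using t(2) u(2) power_map_power_map by auto
    then show ?thesis
      using u by (simp add: transfer_power_map[OF injm] transfer_outside)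
  qed (simp add: t(1) transfer_outside)
  then show "transfer G m (transfer G n f) t = transfer G (m * n) f t"
    using t by (simp add: transfer_outside)
qed (rule transfer_extensional)+

lemma transfer_one:
  assumes "f \<in> extensional (carrier G)"
  shows "transfer G 1 f = f"
proof (rule extensionalityI[OF transfer_extensional assms])
  fix t assume t: "t \<in> carrier G"
  have "inj_on (power_map G 1) (carrier G)"
    by (simp add: inj_on_def power_map_def)
  from transfer_power_map[OF this t] show "transfer G 1 f t = f t"
    using power_map_one[OF t] by simp
qed

lemma beta_cont_fun:
  assumes "n \<ge> 1" "f \<in> cont_fun T"
  shows "beta G n f \<in> cont_fun T"
proof -
  have "continuous_map T euclidean (\<lambda>t. f (power_map G n t))"
    using continuous_map_compose[OF continuous_map_power_map[OF assms(1)]] assms(2)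
    by (auto simp: in_cont_fun_iff o_def)
  then show ?thesis
    using cont_fun_restrict[of T] by (simp add: beta_def topspace_eq)
qed

lemma beta_star_endo:
  assumes "n \<ge> 1"
  shows "beta G n \<in> star_endo T"
  unfolding star_endo_def topspace_eq
  using beta_cont_fun[OF assms]
  by (auto simp: beta_def power_map_closed intro!: restrict_ext)

lemma beta_beta: "beta G m (beta G n f) = beta G (m * n) f"
  by (auto simp: beta_def power_map_closed power_map_power_map mult.commute intro!: restrict_ext)

lemma beta_one:
  assumes "f \<in> extensional (carrier G)"
  shows "beta G 1 f = f"
  using assms by (intro extensionalityI[of _ "carrier G"]) (simp_all add: beta_def power_map_def)

lemma beta_transfer:
  assumes "inj_on (power_map G n) (carrier G)" "f \<in> extensional (carrier G)"
  shows "beta G n (transfer G n f) = f"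
  using assms(2) transfer_power_map[OF assms(1)]
  by (intro extensionalityI[of _ "carrier G"]) (simp_all add: beta_def)

lemma beta_surjective:
  assumes "n \<ge> 1"
    and "inj_on (power_map G n) (carrier G)"
    and "finite (rcosets (power_map G n ` carrier G))"
  shows "beta G n ` cont_fun T = cont_fun T"
proof
  show "beta G n ` cont_fun T \<subseteq> cont_fun T"
    using beta_cont_fun[OF assms(1)] by blast
  show "cont_fun T \<subseteq> beta G n ` cont_fun T"
  proof
    fix f assume f: "f \<in> cont_fun T"
    then have "f = beta G n (transfer G n f)"
      using beta_transfer[OF assms(2)] by (simp add: in_cont_fun_iff topspace_eq)
    then show "f \<in> beta G n ` cont_fun T"
      using transfer_cont_fun[OF assms f] by blast
  qed
qed

end

theorem proposition4p3:
  fixes G :: "('a, 'm) monoid_scheme" and T :: "'a topology"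
  assumes "compact_abelian_group G T"
    and "\<forall>n\<ge>1. inj_on (power_map G n) (carrier G)"
    and "\<forall>n\<ge>1. finite (rcosets\<^bsub>G\<^esub> (power_map G n ` carrier G))"
  shows "nat_action (cont_fun T) {h \<in> star_endo T. h ` cont_fun T = cont_fun T} (beta G)
    \<and> (\<forall>n\<ge>1. \<forall>f\<in>cont_fun T. \<forall>t\<in>carrier G.
         transfer G n f t =
           (if t \<in> power_map G n ` carrier G
            then f (inv_into (carrier G) (power_map G n) t) else 0))
    \<and> nat_action (cont_fun T) (star_endo T) (transfer G)"
proof -
  interpret compact_abelian_group G T
    by fact
  have ext: "f \<in> extensional (carrier G)" if "f \<in> cont_fun T" for f
    using that by (simp add: in_cont_fun_iff topspace_eq)
  have "nat_action (cont_fun T) {h \<in> star_endo T. h ` cont_fun T = cont_fun T} (beta G)"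
    unfolding nat_action_def
    using assms(2,3) beta_star_endo beta_surjective beta_beta beta_one[OF ext] by simp
  moreover have "nat_action (cont_fun T) (star_endo T) (transfer G)"
    unfolding nat_action_def
    using assms(2,3) transfer_star_endo transfer_transfer transfer_one[OF ext] by simp
  ultimately show ?thesis
    using assms(2) transfer_eq_inverse by blast
qed

end
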